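(* Let $f(z)=\alpha z+a_2z^2+\cdots$, $0<\alpha\le1$, be a spherically convex function on $\mathbb{D}$. Then $$\operatorname{Re}\{a_2f(z)\}\ge-\frac{\alpha^2}{2}$$ for all $z\in\mathbb{D}$. The constant $-\alpha^2/2$ is the best possible.
   Context: $\mathbb{D}=\{z\in\mathbb{C}:|z|<1\}$. A spherically convex function is a univalent mapping $f$ on $\mathbb{D}$ with $f(0)=0$, $f'(0)=\alpha\in(0,1]$, whose image $f(\mathbb{D})$ is a spherically convex subset of the Riemann sphere, meaning convex with respect to spherical geodesics.
   Formalization: "Best possible" is read uniformly in α: no c > −1/2 gives Re{a₂f(z)} ≥ cα² for all α, f and z. For a fixed α the constant −α²/2 is not best possible: e.g. α = 1 forces f(z) = z, so a₂ = 0. *)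

theory Defs
  imports "HOL-Complex_Analysis.Complex_Analysis"
begin

text \<open>
  The Riemann sphere is the unit sphere of \<^typ>\<open>complex \<times> real\<close>, with \<open>\<infinity>\<close> at the north
  pole \<open>(0, 1)\<close>. The origin goes to the south pole, and the unit circle to the equator.
\<close>

definition to_riemann_sphere :: "complex \<Rightarrow> complex \<times> real" where
  "to_riemann_sphere w =
     ((2 / (1 + (cmod w)\<^sup>2)) *\<^sub>R w, ((cmod w)\<^sup>2 - 1) / ((cmod w)\<^sup>2 + 1))"

text \<open>
  For a unit vector \<open>u\<close> orthogonal to \<open>p\<close>, the curve \<open>t \<mapsto> cos t p + sin t u\<close> is the
  great circle through \<open>p\<close> in the direction \<open>u\<close>, parametrised by arc length. It is a shortest
  path on \<open>[0, L]\<close> exactly when \<open>L \<le> \<pi>\<close>. Two points that are not antipodal are joined by one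
  such arc, antipodal points by every great semicircle between them (\<open>L = \<pi>\<close>).
\<close>

definition spherically_convex :: "(complex \<times> real) set \<Rightarrow> bool" where
  "spherically_convex S \<longleftrightarrow> S \<subseteq> sphere 0 1 \<and>
     (\<forall>p\<in>S. \<forall>u L. norm u = 1 \<and> p \<bullet> u = 0 \<and> 0 \<le> L \<and> L \<le> pi \<and>
        cos L *\<^sub>R p + sin L *\<^sub>R u \<in> S \<longrightarrow>
        (\<forall>t\<in>{0..L}. cos t *\<^sub>R p + sin t *\<^sub>R u \<in> S))"

definition spherically_convex_fun :: "real \<Rightarrow> (complex \<Rightarrow> complex) \<Rightarrow> bool" where
  "spherically_convex_fun \<alpha> f \<longleftrightarrow>
     f holomorphic_on ball 0 1 \<and> inj_on f (ball 0 1) \<and>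
     f 0 = 0 \<and> 0 < \<alpha> \<and> \<alpha> \<le> 1 \<and> deriv f 0 = complex_of_real \<alpha> \<and>
     spherically_convex (to_riemann_sphere ` f ` ball 0 1)"

end

theory Submission imports Defs begin

text \<open>
  A spherically convex plane domain \<open>\<Omega>\<close> containing \<open>0\<close> is also convex in the Euclidean sense:
  the cone over its lift to the sphere is convex and contains the south pole, and the
  lift of a Euclidean convex combination of two points is, up to scaling, the corresponding
  combination of their lifts plus a nonnegative multiple of the south pole.

  If \<open>f\<close> maps the disc conformally onto a convex domain \<open>\<Omega>\<close> and \<open>w \<in> \<Omega>\<close>, then
  \<open>F\<^sub>t = f\<inverse> \<circ> ((1 - t) f + t w)\<close> is a self-map of the disc, so \<open>\<bar>F\<^sub>t'(0)\<bar> \<le> 1\<close>, with equality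
  at \<open>t = 0\<close>. Differentiating at \<open>t = 0\<close> gives \<open>Re (1 + 2 a\<^sub>2 w / \<alpha>\<^sup>2) \<ge> 0\<close>.

  Sharpness comes from the conformal maps \<open>\<alpha> z / (1 - b z)\<close>, with \<open>\<alpha>\<^sup>2 + b\<^sup>2 = 1\<close>, onto
  hemispheres containing the origin, as \<open>b \<rightarrow> 1\<close>.
\<close>

section \<open>Positive combinations in a spherically convex set\<close>

text \<open>The ray through a nonnegative combination of \<open>p\<close> and \<open>q\<close> meets
  the sphere on the short arc between them. Gram-Schmidt supplies the unit tangent \<open>u\<close>
  at \<open>p\<close> towards \<open>q\<close>, and comparing angles puts the point on the
  arc.\<close>

lemma spherically_convex_sgn_combination:
  assumes S: "spherically_convex S" and p: "p \<in> S" and q: "q \<in> S"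
    and a: "a \<ge> 0" and b: "b \<ge> 0" and nz: "a *\<^sub>R p + b *\<^sub>R q \<noteq> 0"
  shows "sgn (a *\<^sub>R p + b *\<^sub>R q) \<in> S"
proof -
  have np: "norm p = 1" and nq: "norm q = 1"
    using S p q unfolding spherically_convex_def by auto
  define c where "c = p \<bullet> q"
  define s where "s = norm (q - c *\<^sub>R p)"
  show ?thesis
  proof (cases "s = 0")
    \<comment> \<open>Here \<open>q\<close> is \<open>p\<close> or its antipode, so no direction
      \<open>u\<close> is singled out; the combination is a multiple of \<open>p\<close> and
      normalises to \<open>p\<close> or to \<open>q\<close>.\<close>
    case True
    then have qc: "q = c *\<^sub>R p" unfolding s_def by simp
    with np nq have "\<bar>c\<bar> = 1" by simp
    then have eq: "a *\<^sub>R p + b *\<^sub>R q = (a + b * c) *\<^sub>R p"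
      using qc by (simp add: algebra_simps)
    from \<open>\<bar>c\<bar> = 1\<close> have "c = 1 \<or> c = -1" by linarith
    moreover have "sgn p = p" using np by (simp add: sgn_div_norm)
    moreover have "a + b * c \<noteq> 0" using nz eq by auto
    ultimately show ?thesis
      using p q qc a b unfolding eq
      by (auto simp: sgn_scaleR sgn_real_def split: if_splits)
  next
    case False
    then have s: "s > 0" unfolding s_def by simp
    define u where "u = (1 / s) *\<^sub>R (q - c *\<^sub>R p)"
    have nu: "norm u = 1" using s unfolding u_def s_def by simp
    have pp: "p \<bullet> p = 1" and uu: "u \<bullet> u = 1" using np nu by (simp_all add: norm_eq_1)
    have pu: "p \<bullet> u = 0" using pp unfolding u_def c_def by (simp add: inner_diff_right)
    have q_eq: "q = c *\<^sub>R p + s *\<^sub>R u" using s unfolding u_def by simp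
    have cs: "c\<^sup>2 + s\<^sup>2 = 1"
    proof -
      have "q \<bullet> q = c\<^sup>2 + s\<^sup>2" unfolding q_eq using pp uu pu
        by (simp add: inner_add_left inner_add_right inner_commute power2_eq_square)
      then show ?thesis using nq by (simp add: norm_eq_1)
    qed
    define L where "L = arccos c"
    have "c\<^sup>2 \<le> 1" using cs by (smt (verit) zero_le_power2)
    then have c1: "\<bar>c\<bar> \<le> 1" by (simp add: abs_square_le_1)
    have cosL: "cos L = c" unfolding L_def using c1 by (simp add: cos_arccos_abs)
    have L: "0 \<le> L" "L \<le> pi" unfolding L_def using c1 by (auto simp: arccos_lbound arccos_ubound)
    have sinL: "sin L = s"
    proof -
      have "(sin L)\<^sup>2 = s\<^sup>2" using cs cosL sin_cos_squared_add[of L] by (simp add: algebra_simps)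
      then show ?thesis using s sin_ge_zero[OF L] by (simp add: power2_eq_iff_nonneg)
    qed
    have Lpos: "L > 0" using L s sinL by (metis less_le sin_zero)
    define n where "n = norm (a *\<^sub>R p + b *\<^sub>R q)"
    have n: "n > 0" unfolding n_def using nz by simp
    define x where "x = (a + b * c) / n"
    define y where "y = b * s / n"
    have v_eq: "sgn (a *\<^sub>R p + b *\<^sub>R q) = x *\<^sub>R p + y *\<^sub>R u"
    proof -
      have "a *\<^sub>R p + b *\<^sub>R q = (a + b * c) *\<^sub>R p + (b * s) *\<^sub>R u"
        by (subst q_eq) (simp add: algebra_simps)
      moreover have "sgn (a *\<^sub>R p + b *\<^sub>R q) = inverse n *\<^sub>R (a *\<^sub>R p + b *\<^sub>R q)"
        by (simp add: sgn_div_norm n_def)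
      ultimately show ?thesis
        by (simp add: x_def y_def scaleR_add_right divide_inverse mult.commute)
    qed
    have y0: "y \<ge> 0" unfolding y_def using b s n by simp
    have xy: "x\<^sup>2 + y\<^sup>2 = 1"
    proof -
      have "norm (x *\<^sub>R p + y *\<^sub>R u) = 1"
        using nz unfolding v_eq[symmetric] by (simp add: norm_sgn)
      then have "(x *\<^sub>R p + y *\<^sub>R u) \<bullet> (x *\<^sub>R p + y *\<^sub>R u) = 1" by (simp add: norm_eq_1)
      then show ?thesis using pp uu pu
        by (simp add: inner_add_left inner_add_right inner_commute power2_eq_square)
    qed
    define t where "t = arccos x"
    have "x\<^sup>2 \<le> 1" using xy by (smt (verit) zero_le_power2)
    then have x1: "\<bar>x\<bar> \<le> 1" by (simp add: abs_square_le_1)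
    have cost: "cos t = x" unfolding t_def using x1 by (simp add: cos_arccos_abs)
    have t: "0 \<le> t" "t \<le> pi" unfolding t_def using x1 by (auto simp: arccos_lbound arccos_ubound)
    have sint: "sin t = y"
    proof -
      have "(sin t)\<^sup>2 = y\<^sup>2" using xy cost sin_cos_squared_add[of t] by (simp add: algebra_simps)
      then show ?thesis using y0 sin_ge_zero[OF t] by (simp add: power2_eq_iff_nonneg)
    qed
    \<comment> \<open>The terms in \<open>b\<close> cancel, so the sign of \<open>a\<close> decides
      on which side of \<open>L\<close> the angle \<open>t\<close> lies.\<close>
    have "sin (L - t) = a * s / n"
      unfolding sin_diff cosL sinL cost sint x_def y_def using n by (simp add: field_simps)
    then have "sin (L - t) \<ge> 0" using a s n by simp
    \<comment> \<open>Since \<open>L > 0\<close> and \<open>t \<le> pi\<close>, the difference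
      \<open>t - L\<close> is below \<open>pi\<close>; were it positive, its sine would be positive
      too.\<close>
    then have "t \<le> L"
      using sin_gt_zero[of "t - L"] t Lpos by (smt (verit) sin_minus)
    moreover have "cos L *\<^sub>R p + sin L *\<^sub>R u \<in> S" using q q_eq cosL sinL by simp
    ultimately have "cos t *\<^sub>R p + sin t *\<^sub>R u \<in> S"
      using S p nu pu L t(1) unfolding spherically_convex_def by (metis atLeastAtMost_iff)
    then show ?thesis unfolding v_eq cost sint .
  qed
qed

text \<open>The first two terms are merged into one point of \<open>S\<close>, rescaled by their
  norm, and then combined with \<open>r\<close>; if they cancel, only \<open>r\<close>
  remains.\<close>

lemma spherically_convex_sgn_combination3:
  assumes S: "spherically_convex S" and p: "p \<in> S" and q: "q \<in> S" and r: "r \<in> S"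
    and a: "a \<ge> 0" and b: "b \<ge> 0" and c: "c \<ge> 0"
    and nz: "a *\<^sub>R p + b *\<^sub>R q + c *\<^sub>R r \<noteq> 0"
  shows "sgn (a *\<^sub>R p + b *\<^sub>R q + c *\<^sub>R r) \<in> S"
proof (cases "a *\<^sub>R p + b *\<^sub>R q = 0")
  case True
  then show ?thesis
    using spherically_convex_sgn_combination[OF S r r c order_refl] nz by simp
next
  case False
  define v where "v = a *\<^sub>R p + b *\<^sub>R q"
  have v: "norm v *\<^sub>R sgn v = v" using False unfolding v_def by (simp add: sgn_div_norm)
  have "sgn v \<in> S"
    unfolding v_def by (rule spherically_convex_sgn_combination[OF S p q a b False])
  moreover have "norm v *\<^sub>R sgn v + c *\<^sub>R r \<noteq> 0" using nz unfolding v by (simp add: v_def)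
  ultimately have "sgn (norm v *\<^sub>R sgn v + c *\<^sub>R r) \<in> S"
    by (intro spherically_convex_sgn_combination[OF S _ r norm_ge_zero c])
  then show ?thesis unfolding v by (simp add: v_def)
qed

section \<open>From spherical to Euclidean convexity\<close>

text \<open>The point of the sphere rescaled by \<open>1 + (cmod w)\<^sup>2\<close>: it stays on the
  same ray but is polynomial in the coordinates, so convex combinations can be compared without
  denominators.\<close>

definition sphere_lift :: "complex \<Rightarrow> complex \<times> real" where
  "sphere_lift w = (2 *\<^sub>R w, (cmod w)\<^sup>2 - 1)"

lemma to_riemann_sphere_eq:
  "to_riemann_sphere w = (1 / (1 + (cmod w)\<^sup>2)) *\<^sub>R sphere_lift w"
  by (simp add: to_riemann_sphere_def sphere_lift_def add.commute)

lemma one_plus_norm_square_pos: "1 + (cmod w)\<^sup>2 > 0"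
  by (simp add: add_pos_nonneg)

lemma norm_to_riemann_sphere: "norm (to_riemann_sphere w) = 1"
proof -
  have "(norm (sphere_lift w))\<^sup>2 = (1 + (cmod w)\<^sup>2)\<^sup>2"
    by (simp add: sphere_lift_def norm_Pair power_mult_distrib)
       (simp add: power2_eq_square algebra_simps)
  then have "norm (sphere_lift w) = 1 + (cmod w)\<^sup>2"
    using one_plus_norm_square_pos[of w] by (simp add: power2_eq_iff_nonneg)
  then show ?thesis
    using one_plus_norm_square_pos[of w] by (simp add: to_riemann_sphere_eq)
qed

lemma sphere_lift_eq: "sphere_lift w = (1 + (cmod w)\<^sup>2) *\<^sub>R to_riemann_sphere w"
  using one_plus_norm_square_pos[of w] by (simp add: to_riemann_sphere_eq)

lemma sgn_sphere_lift: "sgn (sphere_lift w) = to_riemann_sphere w"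
  using one_plus_norm_square_pos[of w] norm_to_riemann_sphere[of w]
  by (simp add: sphere_lift_eq sgn_scaleR sgn_div_norm)

lemma inj_to_riemann_sphere: "inj to_riemann_sphere"
proof (rule injI)
  fix v w assume eq: "to_riemann_sphere v = to_riemann_sphere w"
  have pos: "1 + (cmod v)\<^sup>2 > 0" "1 + (cmod w)\<^sup>2 > 0" by (rule one_plus_norm_square_pos)+
  have "((cmod v)\<^sup>2 - 1) / ((cmod v)\<^sup>2 + 1) = ((cmod w)\<^sup>2 - 1) / ((cmod w)\<^sup>2 + 1)"
    using eq by (simp add: to_riemann_sphere_def)
  then have n: "(cmod v)\<^sup>2 = (cmod w)\<^sup>2"
    using pos by (simp add: field_simps)
  have "(2 / (1 + (cmod w)\<^sup>2)) *\<^sub>R v = (2 / (1 + (cmod w)\<^sup>2)) *\<^sub>R w"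
    using eq n by (simp add: to_riemann_sphere_def)
  then show "v = w" using pos by simp
qed

lemma spherically_convex_imp_convex:
  assumes S: "spherically_convex (to_riemann_sphere ` A)" and 0: "0 \<in> A"
  shows "convex A"
  unfolding convex_alt
proof (intro ballI allI impI)
  fix v w and t :: real assume v: "v \<in> A" and w: "w \<in> A" and t: "0 \<le> t \<and> t \<le> 1"
  define x where "x = (1 - t) *\<^sub>R v + t *\<^sub>R w"
  \<comment> \<open>The convexity gap of the squared modulus. The combined lifts lie higher than the
    lift of \<open>x\<close> by exactly this amount, and \<open>sphere_lift 0 = (0, -1)\<close>
    points straight down.\<close>
  define d where "d = (1 - t) * (cmod v)\<^sup>2 + t * (cmod w)\<^sup>2 - (cmod x)\<^sup>2"
  have "d = t * (1 - t) * (cmod (v - w))\<^sup>2"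
    unfolding d_def x_def cmod_power2 by (simp add: power2_eq_square algebra_simps)
  then have d: "d \<ge> 0" using t by simp
  have lift: "sphere_lift x = (1 - t) *\<^sub>R sphere_lift v + t *\<^sub>R sphere_lift w + d *\<^sub>R sphere_lift 0"
    by (simp add: sphere_lift_def d_def x_def algebra_simps)
  have "sgn (((1 - t) * (1 + (cmod v)\<^sup>2)) *\<^sub>R to_riemann_sphere v
      + (t * (1 + (cmod w)\<^sup>2)) *\<^sub>R to_riemann_sphere w
      + (d * (1 + (cmod 0)\<^sup>2)) *\<^sub>R to_riemann_sphere 0) \<in> to_riemann_sphere ` A"
  proof (rule spherically_convex_sgn_combination3[OF S])
    have "sphere_lift x \<noteq> 0"
      using norm_to_riemann_sphere[of x] by (auto simp: to_riemann_sphere_eq)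
    then show "((1 - t) * (1 + (cmod v)\<^sup>2)) *\<^sub>R to_riemann_sphere v
      + (t * (1 + (cmod w)\<^sup>2)) *\<^sub>R to_riemann_sphere w
      + (d * (1 + (cmod 0)\<^sup>2)) *\<^sub>R to_riemann_sphere 0 \<noteq> 0"
      unfolding lift by (simp only: sphere_lift_eq scaleR_scaleR not_False_eq_True)
  qed (use v w 0 t d in auto)
  then have "to_riemann_sphere x \<in> to_riemann_sphere ` A"
    unfolding sgn_sphere_lift[symmetric, of x] lift by (simp only: sphere_lift_eq scaleR_scaleR)
  then show "(1 - t) *\<^sub>R v + t *\<^sub>R w \<in> A"
    using inj_to_riemann_sphere by (simp add: inj_image_mem_iff x_def)
qed

section \<open>The second coefficient of a convex univalent map\<close>

text \<open>Cauchy's inequality on the circle of radius \<open>r\<close> gives the bound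
  \<open>1 / r\<close>, with \<open>r\<close> arbitrarily close to 1. There is no normalisation at
  the origin because the self-maps considered next move it.\<close>

lemma norm_deriv_disc_self_map_le_1:
  assumes hol: "F holomorphic_on ball 0 1" and le: "\<And>z. z \<in> ball 0 1 \<Longrightarrow> norm (F z) \<le> 1"
  shows "norm (deriv F 0) \<le> 1"
proof (rule ccontr)
  assume "\<not> ?thesis"
  then have gt: "norm (deriv F 0) > 1" by simp
  then have "1 / norm (deriv F 0) < 1" by (subst divide_less_eq_1_pos) auto
  \<comment> \<open>Chosen so that Cauchy's bound \<open>1 / r\<close> falls below the supposed
    value of the derivative.\<close>
  then obtain r where r: "1 / norm (deriv F 0) < r" "r < 1"
    using dense by blast
  have r0: "r > 0" using r(1) gt by (smt (verit) divide_pos_pos)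
  have sub: "cball 0 r \<subseteq> ball (0::complex) 1" using r by auto
  have "norm ((deriv ^^ 1) F 0) \<le> fact 1 * 1 / r ^ 1"
  proof (rule Cauchy_inequality)
    show "F holomorphic_on ball 0 r" "continuous_on (cball 0 r) F"
      using holomorphic_on_subset[OF hol sub] ball_subset_cball
      by (auto intro: holomorphic_on_subset holomorphic_on_imp_continuous_on)
  qed (use r0 r le in auto)
  then have "norm (deriv F 0) \<le> 1 / r" by simp
  moreover have "1 < r * norm (deriv F 0)"
    using r(1) gt by (subst (asm) pos_divide_less_eq) auto
  ultimately show False using r0 by (simp add: field_simps)
qed

text \<open>Contracting the image towards \<open>w\<close> cannot raise the derivative at 0 of the
  induced self-map above modulus 1; the inequality is the first-order condition at the start of the
  contraction.\<close>

lemma convex_univalent_second_deriv: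
  assumes hol: "f holomorphic_on ball 0 1" and inj: "inj_on f (ball 0 1)"
    and f0: "f 0 = 0" and cvx: "convex (f ` ball 0 1)" and w: "w \<in> f ` ball 0 1"
  shows "Re (1 + deriv (deriv f) 0 / (deriv f 0)\<^sup>2 * w) \<ge> 0"
proof -
  define \<Omega> where "\<Omega> = f ` ball 0 1"
  obtain g where g: "g holomorphic_on \<Omega>"
    and dg: "\<And>z. z \<in> ball 0 1 \<Longrightarrow> deriv f z * deriv g (f z) = 1"
    and gf: "\<And>z. z \<in> ball 0 1 \<Longrightarrow> g (f z) = z"
    using holomorphic_has_inverse[OF hol open_ball inj] unfolding \<Omega>_def by blast
  have op: "open \<Omega>" unfolding \<Omega>_def by (rule open_mapping_thm3[OF hol open_ball inj])
  have z0: "0 \<in> \<Omega>" unfolding \<Omega>_def using f0 by (metis centre_in_ball imageI zero_less_one)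
  have f'0: "deriv f 0 \<noteq> 0" using dg[of 0] by auto
  have g0: "g 0 = 0" using gf[of 0] f0 by simp
  have g'0: "deriv g 0 = 1 / deriv f 0" using dg[of 0] f0 f'0 by (simp add: field_simps)
  \<comment> \<open>By the chain rule this is the derivative at 0 of the self-map with parameter
    \<open>s\<close>. A complex parameter lets \<open>H\<close> be differentiated by the complex
    rules before restricting to real \<open>t\<close>.\<close>
  define H where "H s = (1 - s) * deriv f 0 / deriv f (g (s * w))" for s
  have bound: "norm (H (of_real t)) \<le> 1" if t: "0 \<le> t" "t \<le> 1" for t
  proof -
    define F where "F z = g ((1 - t) *\<^sub>R f z + t *\<^sub>R w)" for z
    have in\<Omega>: "(1 - t) *\<^sub>R f z + t *\<^sub>R w \<in> \<Omega>" if "z \<in> ball 0 1" for z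
      using cvx w that t unfolding convex_alt \<Omega>_def by blast
    have tw: "of_real t * w \<in> \<Omega>" using in\<Omega>[of 0] f0 by (simp add: scaleR_conv_of_real)
    have "F holomorphic_on ball 0 1"
      unfolding F_def using in\<Omega>
      by (intro holomorphic_on_compose_gen[OF _ g, unfolded o_def] holomorphic_intros hol) auto
    moreover have "norm (F z) \<le> 1" if z: "z \<in> ball 0 1" for z
    proof -
      obtain y where "y \<in> ball 0 1" "f y = (1 - t) *\<^sub>R f z + t *\<^sub>R w"
        using in\<Omega>[OF z] unfolding \<Omega>_def by force
      then show ?thesis unfolding F_def using gf[of y] by auto
    qed
    ultimately have le: "norm (deriv F 0) \<le> 1" by (rule norm_deriv_disc_self_map_le_1)
    obtain y where y: "y \<in> ball 0 1" "f y = of_real t * w" using tw unfolding \<Omega>_def by force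
    have gy: "deriv g (of_real t * w) = 1 / deriv f (g (of_real t * w))"
      using dg[OF y(1)] gf[OF y(1)] y(2) by (metis mult_zero_left nonzero_eq_divide_eq
          mult.commute zero_neq_one)
    have 1: "(g has_field_derivative deriv g (of_real t * w)) (at (of_real t * w))"
      using g op tw by (rule holomorphic_derivI)
    have 2: "(f has_field_derivative deriv f 0) (at 0)"
      using hol by (rule holomorphic_derivI) auto
    have "((\<lambda>z. (1 - of_real t) * f z + of_real t * w) has_field_derivative
        (1 - of_real t) * deriv f 0) (at 0)"
      using 2 by (auto intro!: derivative_eq_intros)
    then have "((\<lambda>z. g ((1 - of_real t) * f z + of_real t * w)) has_field_derivative
        deriv g (of_real t * w) * ((1 - of_real t) * deriv f 0)) (at 0)"
      using DERIV_chain2[of g _ "\<lambda>z. (1 - of_real t) * f z + of_real t * w" 0] 1 f0 by simp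
    then have "deriv F 0 = deriv g (of_real t * w) * ((1 - of_real t) * deriv f 0)"
      unfolding F_def scaleR_conv_of_real by (simp add: DERIV_imp_deriv)
    then have "deriv F 0 = H (of_real t)" unfolding gy H_def by simp
    then show ?thesis using le by simp
  qed
  have "((\<lambda>s. g (s * w)) has_field_derivative (1 / deriv f 0 * w)) (at 0)"
  proof -
    have "(g has_field_derivative 1 / deriv f 0) (at (0 * w))"
      using holomorphic_derivI[OF g op z0] g'0 by simp
    moreover have "((\<lambda>s. s * w) has_field_derivative w) (at 0)"
      by (auto intro!: derivative_eq_intros)
    ultimately show ?thesis by (rule DERIV_chain2)
  qed
  moreover have "(deriv f has_field_derivative deriv (deriv f) 0) (at (g (0 * w)))"
    using holomorphic_derivI[OF holomorphic_deriv[OF hol open_ball] open_ball, of 0] g0 by simp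
  ultimately have dfg: "((\<lambda>s. deriv f (g (s * w))) has_field_derivative
      deriv (deriv f) 0 * (1 / deriv f 0 * w)) (at 0)"
    by (rule DERIV_chain2[rotated])
  define D where "D = - 1 - deriv (deriv f) 0 / (deriv f 0)\<^sup>2 * w"
  have "(H has_field_derivative D) (at (of_real 0))"
    unfolding H_def D_def
    by (rule derivative_eq_intros dfg refl | simp add: g0 f'0)+
       (use f'0 in \<open>simp add: field_simps power2_eq_square\<close>)
  then have "((\<lambda>t. H (of_real t)) has_vector_derivative D) (at 0)"
    by (rule has_vector_derivative_real_field)
  then have der: "((\<lambda>t. Re (H (of_real t))) has_real_derivative Re D) (at 0)"
    by (rule has_field_derivative_Re)
  \<comment> \<open>On \<open>[0, 1]\<close> the real part of \<open>H\<close> is at most 1, its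
    value at 0; a positive derivative there would exceed this at once.\<close>
  have "Re D \<le> 0"
  proof (rule ccontr)
    assume "\<not> Re D \<le> 0"
    then obtain d where d: "d > 0"
      "\<And>h. 0 < h \<Longrightarrow> h < d \<Longrightarrow> Re (H (of_real 0)) < Re (H (of_real (0 + h)))"
      using DERIV_pos_inc_right[OF der] by auto
    \<comment> \<open>This parameter is positive, below \<open>d\<close>, and within the range
      \<open>[0, 1]\<close> of \<open>bound\<close>.\<close>
    have "Re (H (of_real 0)) < Re (H (of_real (min (d / 2) 1)))"
      using d(2)[of "min (d / 2) 1"] d(1) by auto
    moreover have "H (of_real 0) = 1" using f'0 g0 by (simp add: H_def)
    moreover have "Re (H (of_real (min (d / 2) 1))) \<le> 1"
      using bound[of "min (d / 2) 1"] d(1) complex_Re_le_cmod order_trans by fastforce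
    ultimately show False by simp
  qed
  then show ?thesis unfolding D_def by simp
qed

section \<open>The lower bound for spherically convex functions\<close>

lemma fps_expansion_nth_2: "fps_nth (fps_expansion f 0) 2 = deriv (deriv f) 0 / 2"
  by (simp add: fps_expansion_def numeral_2_eq_2)

lemma spherically_convex_fun_bound:
  assumes f: "spherically_convex_fun \<alpha> f" and z: "z \<in> ball 0 1"
  shows "Re (fps_nth (fps_expansion f 0) 2 * f z) \<ge> - (\<alpha>\<^sup>2 / 2)"
proof -
  have \<alpha>: "\<alpha> > 0" and f': "deriv f 0 = of_real \<alpha>" and f0: "f 0 = 0"
    and hol: "f holomorphic_on ball 0 1" and inj: "inj_on f (ball 0 1)"
    and sc: "spherically_convex (to_riemann_sphere ` f ` ball 0 1)"
    using f unfolding spherically_convex_fun_def by auto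
  have "0 \<in> f ` ball 0 1" using f0 by (metis centre_in_ball imageI zero_less_one)
  with sc have "convex (f ` ball 0 1)" by (rule spherically_convex_imp_convex)
  then have "Re (1 + deriv (deriv f) 0 / (deriv f 0)\<^sup>2 * f z) \<ge> 0"
    using hol inj f0 z by (intro convex_univalent_second_deriv) auto
  also have "1 + deriv (deriv f) 0 / (deriv f 0)\<^sup>2 * f z
      = 1 + deriv (deriv f) 0 * f z / of_real (\<alpha>\<^sup>2)"
    unfolding f' by simp
  finally have "0 \<le> 1 + Re (deriv (deriv f) 0 * f z) / \<alpha>\<^sup>2"
    by (simp only: plus_complex.sel one_complex.sel Re_divide_of_real)
  then have "- (\<alpha>\<^sup>2) \<le> Re (deriv (deriv f) 0 * f z)"
    using \<alpha> by (simp add: field_simps)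
  then show ?thesis by (simp add: fps_expansion_nth_2)
qed

section \<open>Hemisphere maps as test functions\<close>

text \<open>Along an arc from \<open>p\<close> to \<open>q\<close> of length \<open>L < pi\<close>,
  \<open>sin L\<close> times the height over the plane orthogonal to \<open>n\<close> is
  \<open>sin (L - t)\<close> times the height of \<open>p\<close> plus \<open>sin t\<close> times
  that of \<open>q\<close>.\<close>

lemma spherically_convex_open_hemisphere:
  "spherically_convex {p \<in> sphere 0 1. p \<bullet> n > 0}"
  unfolding spherically_convex_def
proof (intro conjI ballI allI impI)
  fix p u :: "complex \<times> real" and L t :: real
  assume p: "p \<in> {p \<in> sphere 0 1. p \<bullet> n > 0}"
    and u: "norm u = 1 \<and> p \<bullet> u = 0 \<and> 0 \<le> L \<and> L \<le> pi \<and>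
      cos L *\<^sub>R p + sin L *\<^sub>R u \<in> {p \<in> sphere 0 1. p \<bullet> n > 0}"
    and t: "t \<in> {0..L}"
  have pn: "p \<bullet> n > 0" and np: "norm p = 1" using p by auto
  have qn: "cos L * (p \<bullet> n) + sin L * (u \<bullet> n) > 0" using u by (simp add: inner_add_left)
  have "(norm (cos t *\<^sub>R p + sin t *\<^sub>R u))\<^sup>2 = (cos t)\<^sup>2 + (sin t)\<^sup>2"
    using np u unfolding power2_norm_eq_inner norm_eq_1
    by (simp add: inner_add_left inner_add_right inner_commute power2_eq_square)
  then have "norm (cos t *\<^sub>R p + sin t *\<^sub>R u) = 1"
    by (simp add: power2_eq_1_iff) (smt (verit) norm_ge_zero)
  moreover have "cos t * (p \<bullet> n) + sin t * (u \<bullet> n) > 0"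
  proof (cases "t = 0 \<or> t = L")
    case True
    then show ?thesis using pn qn by auto
  next
    case False
    then have t': "0 < t" "t < L" using t by auto
    \<comment> \<open>For \<open>L = pi\<close> the endpoint would be \<open>-p\<close>, in the
      opposite hemisphere.\<close>
    have "L \<noteq> pi" using qn pn by auto
    then have L: "0 < L" "L < pi" using u t' by auto
    have "sin L * (cos t * (p \<bullet> n) + sin t * (u \<bullet> n))
        = sin (L - t) * (p \<bullet> n) + sin t * (cos L * (p \<bullet> n) + sin L * (u \<bullet> n))"
      unfolding sin_diff by (simp add: algebra_simps)
    also have "\<dots> > 0"
      by (rule add_pos_pos) (rule mult_pos_pos; use t' L pn qn in \<open>simp add: sin_gt_zero\<close>)+
    finally show ?thesis using sin_gt_zero[OF L] by (simp add: zero_less_mult_iff)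
  qed
  ultimately show "cos t *\<^sub>R p + sin t *\<^sub>R u \<in> {p \<in> sphere 0 1. p \<bullet> n > 0}"
    by (simp add: inner_add_left)
qed auto

text \<open>A Moebius map fixing 0 with derivative \<open>a\<close> there. The relation
  \<open>a\<^sup>2 + b\<^sup>2 = 1\<close>, imposed below, makes the image of the unit circle a
  great circle.\<close>

definition hemisphere_map :: "real \<Rightarrow> real \<Rightarrow> complex \<Rightarrow> complex" where
  "hemisphere_map a b z = of_real a * z / (1 - of_real b * z)"

context
  fixes a b :: real
  assumes a: "0 < a" and b: "0 < b" and ab: "a\<^sup>2 + b\<^sup>2 = 1"
begin

lemma b_less_1: "b < 1"
proof -
  have "b\<^sup>2 < 1" using ab zero_less_power[OF a, of 2] by linarith
  then show ?thesis using b by (simp add: power2_less_1_iff)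
qed

lemma one_minus_bz_nonzero: "z \<in> ball 0 1 \<Longrightarrow> 1 - complex_of_real b * z \<noteq> 0"
proof
  assume z: "z \<in> ball 0 1" and "1 - complex_of_real b * z = 0"
  then have "norm (complex_of_real b * z) = 1" by (metis eq_iff_diff_eq_0 norm_one)
  moreover have "b * norm z < 1 * 1" using z b b_less_1 by (intro mult_strict_mono) auto
  ultimately show False using b by (simp add: norm_mult)
qed

lemma hemisphere_map_has_deriv:
  assumes "z \<in> ball 0 1"
  shows "(hemisphere_map a b has_field_derivative of_real a / (1 - of_real b * z)\<^sup>2) (at z)"
  unfolding hemisphere_map_def
  by (rule derivative_eq_intros refl one_minus_bz_nonzero[OF assms])+
     (use one_minus_bz_nonzero[OF assms] in \<open>simp add: field_simps power2_eq_square\<close>)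

lemma hemisphere_map_deriv_0: "deriv (hemisphere_map a b) 0 = of_real a"
  using DERIV_imp_deriv[OF hemisphere_map_has_deriv[of 0]] by simp

lemma hemisphere_map_deriv2_0: "deriv (deriv (hemisphere_map a b)) 0 = 2 * of_real a * of_real b"
proof -
  have ev: "eventually (\<lambda>z. deriv (hemisphere_map a b) z = of_real a / (1 - of_real b * z)\<^sup>2) (nhds 0)"
    using DERIV_imp_deriv[OF hemisphere_map_has_deriv]
    by (auto simp: eventually_nhds intro!: exI[of _ "ball 0 1"])
  have "((\<lambda>z. of_real a / (1 - of_real b * z)\<^sup>2) has_field_derivative
      2 * of_real a * of_real b) (at (0::complex))"
    by (auto intro!: derivative_eq_intros)
  then show ?thesis using deriv_cong_ev[OF ev refl] by (simp add: DERIV_imp_deriv)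
qed

text \<open>Clearing the denominator leaves an equation linear in \<open>z\<close>, from which both
  the inverse map \<open>w / (a + b * w)\<close> and injectivity are read off.\<close>

lemma hemisphere_map_eq_iff:
  assumes "z \<in> ball 0 1"
  shows "hemisphere_map a b z = w \<longleftrightarrow> z * (of_real a + of_real b * w) = w"
  unfolding hemisphere_map_def using one_minus_bz_nonzero[OF assms]
  by (auto simp: field_simps)

text \<open>The left side says that the inverse map sends \<open>w\<close> into the disc. Writing
  \<open>(cmod w)\<^sup>2\<close> as \<open>(a\<^sup>2 + b\<^sup>2) * (cmod w)\<^sup>2\<close>
  leaves a common factor \<open>a\<close> in the difference of squares.\<close>

lemma denominator_ineq_iff:
  "cmod w < cmod (of_real a + of_real b * w) \<longleftrightarrow> a * ((cmod w)\<^sup>2 - 1) < 2 * b * Re w"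
proof -
  have "(cmod (of_real a + of_real b * w))\<^sup>2 = a\<^sup>2 + 2 * a * b * Re w + b\<^sup>2 * (cmod w)\<^sup>2"
    unfolding cmod_power2 by (simp add: power2_eq_square algebra_simps)
  moreover have "(cmod w)\<^sup>2 = a\<^sup>2 * (cmod w)\<^sup>2 + b\<^sup>2 * (cmod w)\<^sup>2"
    using ab by (metis distrib_right mult_1)
  ultimately have "(cmod (of_real a + of_real b * w))\<^sup>2 - (cmod w)\<^sup>2
      = a * (2 * b * Re w - a * ((cmod w)\<^sup>2 - 1))"
    by (simp add: power2_eq_square algebra_simps)
  moreover have "cmod w < cmod (of_real a + of_real b * w) \<longleftrightarrow>
      (cmod (of_real a + of_real b * w))\<^sup>2 - (cmod w)\<^sup>2 > 0"
    by (auto intro: power_strict_mono power2_less_imp_less)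
  ultimately show ?thesis using a by (simp add: zero_less_mult_iff)
qed

lemma hemisphere_map_image:
  "hemisphere_map a b ` ball 0 1 = {w. a * ((cmod w)\<^sup>2 - 1) < 2 * b * Re w}"
proof (intro set_eqI iffI)
  fix w assume "w \<in> hemisphere_map a b ` ball 0 1"
  then obtain z where z: "z \<in> ball 0 1" and eq: "z * (of_real a + of_real b * w) = w"
    using hemisphere_map_eq_iff by blast
  \<comment> \<open>If this vanished, \<open>eq\<close> would give \<open>w = 0\<close>, and the
    expression would equal \<open>a\<close>.\<close>
  have nz: "of_real a + of_real b * w \<noteq> 0"
    using eq a by auto
  have "cmod w = cmod z * cmod (of_real a + of_real b * w)" using eq by (metis norm_mult)
  also have "\<dots> < 1 * cmod (of_real a + of_real b * w)"
    using z nz by (intro mult_strict_right_mono) auto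
  finally show "w \<in> {w. a * ((cmod w)\<^sup>2 - 1) < 2 * b * Re w}"
    using denominator_ineq_iff by simp
next
  fix w assume "w \<in> {w. a * ((cmod w)\<^sup>2 - 1) < 2 * b * Re w}"
  then have lt: "cmod w < cmod (of_real a + of_real b * w)" using denominator_ineq_iff by simp
  then have nz: "of_real a + of_real b * w \<noteq> 0" by (metis norm_ge_zero norm_zero not_le)
  define z where "z = w / (of_real a + of_real b * w)"
  have z: "z \<in> ball 0 1" using lt nz by (simp add: z_def norm_divide)
  have "hemisphere_map a b z = w"
    using nz by (simp add: hemisphere_map_eq_iff[OF z]) (simp add: z_def)
  then show "w \<in> hemisphere_map a b ` ball 0 1" using z by blast
qed

text \<open>Divided by \<open>1 + (cmod w)\<^sup>2\<close>, the inequality becomes linear on the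
  sphere, with normal \<open>(b, -a)\<close>.\<close>

lemma riemann_sphere_hemisphere:
  "to_riemann_sphere ` {w. a * ((cmod w)\<^sup>2 - 1) < 2 * b * Re w}
    = {p \<in> sphere 0 1. p \<bullet> (of_real b, - a) > 0}"
proof (intro set_eqI iffI)
  have inner: "to_riemann_sphere w \<bullet> (of_real b, - a)
      = (2 * b * Re w - a * ((cmod w)\<^sup>2 - 1)) / (1 + (cmod w)\<^sup>2)" for w
    by (simp add: to_riemann_sphere_eq sphere_lift_def inner_complex_def
        diff_divide_distrib add_divide_distrib algebra_simps)
  have iff: "to_riemann_sphere w \<bullet> (of_real b, - a) > 0 \<longleftrightarrow> a * ((cmod w)\<^sup>2 - 1) < 2 * b * Re w" for w
    unfolding inner using one_plus_norm_square_pos[of w] by (simp add: zero_less_divide_iff)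
  {
    fix p assume "p \<in> to_riemann_sphere ` {w. a * ((cmod w)\<^sup>2 - 1) < 2 * b * Re w}"
    then show "p \<in> {p \<in> sphere 0 1. p \<bullet> (of_real b, - a) > 0}"
      using iff norm_to_riemann_sphere by auto
  next
    fix p :: "complex \<times> real" assume p: "p \<in> {p \<in> sphere 0 1. p \<bullet> (of_real b, - a) > 0}"
    obtain v s where vs: "p = (v, s)" by (cases p)
    have "(norm p)\<^sup>2 = 1" using p by simp
    then have n: "(cmod v)\<^sup>2 + s\<^sup>2 = 1" unfolding vs by (simp add: norm_Pair)
    \<comment> \<open>The north pole has inner product \<open>-a < 0\<close> with the normal, so
      every point of the hemisphere comes from a finite \<open>w\<close>.\<close>
    have s1: "s \<noteq> 1"
    proof
      assume "s = 1"
      then have "v = 0" using n by simp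
      then show False using p a \<open>s = 1\<close> unfolding vs by simp
    qed
    \<comment> \<open>Stereographic projection from the north pole.\<close>
    define w where "w = (1 / (1 - s)) *\<^sub>R v"
    have "(cmod w)\<^sup>2 = (1 - s\<^sup>2) / (1 - s)\<^sup>2"
      using n unfolding w_def by (simp add: power_divide algebra_simps)
    also have "1 - s\<^sup>2 = (1 + s) * (1 - s)" by (simp add: power2_eq_square algebra_simps)
    also have "\<dots> / (1 - s)\<^sup>2 = (1 + s) / (1 - s)" using s1 by (simp add: power2_eq_square)
    finally have "(cmod w)\<^sup>2 = (1 + s) / (1 - s)" .
    then have "1 + (cmod w)\<^sup>2 = 2 / (1 - s)" "(cmod w)\<^sup>2 - 1 = 2 * s / (1 - s)"
      using s1 by (simp_all add: field_simps)
    then have "to_riemann_sphere w = ((1 - s) *\<^sub>R w, s)"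
      unfolding to_riemann_sphere_eq sphere_lift_def using s1 by simp
    then have "to_riemann_sphere w = p" using s1 by (simp add: w_def vs)
    then show "p \<in> to_riemann_sphere ` {w. a * ((cmod w)\<^sup>2 - 1) < 2 * b * Re w}"
      using p iff[of w] by blast
  }
qed

lemma spherically_convex_fun_hemisphere_map: "spherically_convex_fun a (hemisphere_map a b)"
  unfolding spherically_convex_fun_def
proof (intro conjI)
  show "hemisphere_map a b holomorphic_on ball 0 1"
    unfolding holomorphic_on_def field_differentiable_def
    using hemisphere_map_has_deriv has_field_derivative_at_within by blast
  show "inj_on (hemisphere_map a b) (ball 0 1)"
  proof (rule inj_onI)
    fix x y assume x: "x \<in> ball 0 1" and y: "y \<in> ball 0 1"
      and eq: "hemisphere_map a b x = hemisphere_map a b y"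
    define w where "w = hemisphere_map a b x"
    have "x * (of_real a + of_real b * w) = w" "y * (of_real a + of_real b * w) = w"
      using hemisphere_map_eq_iff[OF x] hemisphere_map_eq_iff[OF y] eq w_def by auto
    moreover from this have "of_real a + of_real b * w \<noteq> 0" using a by auto
    ultimately show "x = y" by (metis mult_right_cancel)
  qed
  show "hemisphere_map a b 0 = 0" by (simp add: hemisphere_map_def)
  show "a \<le> 1" using ab by (metis abs_le_square_iff abs_one abs_le_D1 le_add_same_cancel1
        one_power2 zero_le_power2)
  show "spherically_convex (to_riemann_sphere ` hemisphere_map a b ` ball 0 1)"
    unfolding hemisphere_map_image riemann_sphere_hemisphere
    by (rule spherically_convex_open_hemisphere)
qed (simp_all add: a hemisphere_map_deriv_0)

text \<open>Here \<open>a_2 = a * b\<close>. The real part of the map decreases towards its infimum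
  as \<open>z\<close> tends to -1; the point \<open>-b\<close> lies inside the disc and tends to -1
  as \<open>b\<close> tends to 1.\<close>

lemma hemisphere_map_value:
  "Re (fps_nth (fps_expansion (hemisphere_map a b) 0) 2 * hemisphere_map a b (- of_real b))
    = - (b\<^sup>2 / (1 + b\<^sup>2)) * a\<^sup>2"
proof -
  have "fps_nth (fps_expansion (hemisphere_map a b) 0) 2 * hemisphere_map a b (- of_real b)
      = complex_of_real (- (b\<^sup>2 / (1 + b\<^sup>2)) * a\<^sup>2)"
    by (simp add: fps_expansion_nth_2 hemisphere_map_deriv2_0 hemisphere_map_def
        power2_eq_square)
  then show ?thesis by (simp only: Re_complex_of_real)
qed

end

section \<open>Sharpness of the constant\<close>

text \<open>Each hemisphere map bounds \<open>c\<close> by a value above -1/2, since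
  \<open>a\<^sup>2\<close> cancels; letting \<open>b\<close> tend to 1 from the left gives -1/2
  itself.\<close>

lemma spherically_convex_constant_sharp:
  assumes c: "\<And>\<alpha> f z. spherically_convex_fun \<alpha> f \<Longrightarrow> z \<in> ball 0 1 \<Longrightarrow>
      Re (fps_nth (fps_expansion f 0) 2 * f z) \<ge> c * \<alpha>\<^sup>2"
  shows "c \<le> - (1 / 2)"
proof -
  have le: "c \<le> - (b\<^sup>2 / (1 + b\<^sup>2))" if b: "0 < b" "b < 1" for b :: real
  proof -
    define a where "a = sqrt (1 - b\<^sup>2)"
    have "b\<^sup>2 < 1" using b by (simp add: power2_less_1_iff)
    then have a: "a > 0" "a\<^sup>2 + b\<^sup>2 = 1" unfolding a_def by simp_all
    have "c * a\<^sup>2 \<le> - (b\<^sup>2 / (1 + b\<^sup>2)) * a\<^sup>2"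
      unfolding hemisphere_map_value[OF a(1) b(1) a(2), symmetric] using b
      by (intro c spherically_convex_fun_hemisphere_map a b) auto
    then show ?thesis by (rule mult_right_le_imp_le) (use a in simp)
  qed
  have "((\<lambda>b::real. - (b\<^sup>2 / (1 + b\<^sup>2))) \<longlongrightarrow> - (1\<^sup>2 / (1 + 1\<^sup>2))) (at_left 1)"
    by (intro tendsto_intros) auto
  moreover have "eventually (\<lambda>b. c \<le> - (b\<^sup>2 / (1 + b\<^sup>2))) (at_left 1)"
    by (rule eventually_mono[OF eventually_at_left_real[of 0 1]]) (auto intro: le)
  ultimately have "c \<le> - (1\<^sup>2 / (1 + 1\<^sup>2))"
    by (intro tendsto_lowerbound) auto
  then show ?thesis by simp
qed

text \<open>Best possible refers to the factor of \<open>\<alpha>\<^sup>2\<close>, uniform in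
  \<alpha>: in the test family \<alpha> tends to 0 as that factor approaches -1/2.\<close>

theorem theorem2p14:
  "(\<forall>\<alpha> f z. spherically_convex_fun \<alpha> f \<and> z \<in> ball 0 1 \<longrightarrow>
      Re (fps_nth (fps_expansion f 0) 2 * f z) \<ge> - (\<alpha>\<^sup>2 / 2)) \<and>
   (\<forall>c::real. (\<forall>\<alpha> f z. spherically_convex_fun \<alpha> f \<and> z \<in> ball 0 1 \<longrightarrow>
      Re (fps_nth (fps_expansion f 0) 2 * f z) \<ge> c * \<alpha>\<^sup>2) \<longrightarrow> c \<le> - (1 / 2))"
  using spherically_convex_fun_bound spherically_convex_constant_sharp by blast

end
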